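(* Let $\{x^k\}$ be generated by (VFKM) with $S^k=Gx^k-\gamma_kGx^{k-1}$, $\gamma_k\in[0,1)$, and $\widetilde S^k$ the loopless SVRG estimator with mini-batch size $b$, probability $\mathbf{p}\in(0,1)$ and snapshot points $w^k$. Define $$\Delta_k:=\frac1{nb}\sum_{i=1}^n\|G_ix^k-\gamma_kG_ix^{k-1}-(1-\gamma_k)G_iw^k\|^2,\qquad U_k:=\frac1n\sum_{i=1}^n\|G_ix^k-G_ix^{k-1}\|^2.$$ Then, for all $k\ge1$, $$\mathbb{E}_k[\widetilde S^k-S^k]=0,\qquad\mathbb{E}_k[\|\widetilde S^k-S^k\|^2]\le\mathbb{E}_k[\Delta_k],$$ $$\frac{1}{(1-\gamma_k)^2}\mathbb{E}_k[\Delta_k]\le\Big(1-\frac{\mathbf{p}}2\Big)\frac{1}{(1-\gamma_{k-1})^2}\Delta_{k-1}+\frac{4-6\mathbf{p}+3\mathbf{p}^2}{b\mathbf{p}(1-\gamma_k)^2}U_k+\frac{2(2-3\mathbf{p}+\mathbf{p}^2)\gamma_{k-1}^2}{b\mathbf{p}(1-\gamma_{k-1})^2}U_{k-1}.$$ Consequently, $\widetilde S^k$ is a variance-reduced unbiased estimator of $S^k$ with $\rho:=\frac{\mathbf{p}}2\in(0,1)$, $\Theta:=\frac{4-6\mathbf{p}+3\mathbf{p}^2}{b\mathbf{p}}$, $\hat\Theta:=\frac{2(2-3\mathbf{p}+\mathbf{p}^2)}{b\mathbf{p}}$, and $\Delta_k=\frac1{nb}\sum_{i=1}^n\|G_ix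^k-\gamma_kG_ix^{k-1}-(1-\gamma_k)G_iw^k\|^2$.
   Context: Setting. $n,p\ge1$ are integers, $[n]=\{1,\dots,n\}$, $G_i:\mathbb{R}^p\to\mathbb{R}^p$ are single-valued mappings, $Gx:=\frac1n\sum_{i=1}^nG_ix$. Method (VFKM). Given $x^0\in\mathbb{R}^p$, set $x^{-1}:=x^0$. At each $k\ge0$ construct an estimator $\widetilde S^k$ of $S^k:=Gx^k-\gamma_kGx^{k-1}$ (with $\widetilde S^0:=S^0$), and update $x^{k+1}:=x^k+\theta_k(x^k-x^{k-1})-\eta_k\widetilde S^k$ with given deterministic parameters $\theta_k,\gamma_k,\eta_k$. Loopless SVRG estimator. Set $w^0:=x^0$. For $k\ge1$: $w^k:=x^{k-1}$ with probability $\mathbf{p}$ and $w^k:=w^{k-1}$ with probability $1-\mathbf{p}$; draw an i.i.d. (uniform, with replacement) mini-batch $\mathcal{B}_k\subseteq[n]$ of fixed size $b$; the Bernoulli choice and $\mathcal{B}_k$ are fresh (independent of the past and of each other). With $G_{\mathcal{B}_k}x:=\frac1b\sum_{i\in\mathcal{B}_k}G_ix$, $$\widetilde S^k:=(1-\gamma_k)(Gw^k-G_{\mathcal{B}_k}w^k)+G_{\mathcal{B}_k}x^k-\gamma_kG_{\mathcal{B}_k}x^{k-1}.$$ $\mathcal{F}_k$ is the $\sigma$-algebra generated by all randomness of the algorithm up to iteration $k$ before sampling the Bernoulli switch and $\mathcal{B}_k$; $\mathbb{E}_k[\cdot]:=\mathbb{E}[\cdot\mid\mathcal{F}_k]$.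 Variance-reduced unbiased estimator: there exist $\rho\in(0,1)$, $\Theta>0$, $\hat\Theta\ge0$ and nonnegative random variables $\{\Delta_k\}$ such that for all $k\ge1$, almost surely, $\mathbb{E}_k[\widetilde S^k-S^k]=0$, $\mathbb{E}_k[\|\widetilde S^k-S^k\|^2]\le\mathbb{E}_k[\Delta_k]$, and $\frac{1}{(1-\gamma_k)^2}\mathbb{E}_k[\Delta_k]\le\frac{1-\rho}{(1-\gamma_{k-1})^2}\Delta_{k-1}+\frac{\Theta}{(1-\gamma_k)^2}U_k+\frac{\hat\Theta}{(1-\gamma_{k-1})^2}U_{k-1}$. *)

theory Defs
  imports "HOL-Probability.Probability"
begin

text \<open>
  Throughout, \<open>G i\<close> is used for \<open>i \<in> {1..n}\<close>, sequences are indexed by \<^typ>\<open>nat\<close>, and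
  \<open>x (k - 1)\<close> at \<open>k = 0\<close> is \<open>x 0\<close> by truncated subtraction; this is the convention
  that the iterate preceding \<open>x 0\<close> is \<open>x 0\<close> itself.
\<close>

definition G_mean :: "nat \<Rightarrow> (nat \<Rightarrow> real^'p \<Rightarrow> real^'p) \<Rightarrow> real^'p \<Rightarrow> real^'p" where
  "G_mean n G z = (1 / real n) *\<^sub>R (\<Sum>i\<in>{1..n}. G i z)"

text \<open>A mini-batch drawn with replacement is a list of indices, since indices may repeat.\<close>

definition G_batch :: "(nat \<Rightarrow> real^'p \<Rightarrow> real^'p) \<Rightarrow> nat list \<Rightarrow> real^'p \<Rightarrow> real^'p" where
  "G_batch G B z = (1 / real (length B)) *\<^sub>R (\<Sum>i\<leftarrow>B. G i z)"

definition S_target ::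
  "nat \<Rightarrow> (nat \<Rightarrow> real^'p \<Rightarrow> real^'p) \<Rightarrow> (nat \<Rightarrow> real) \<Rightarrow> (nat \<Rightarrow> 'a \<Rightarrow> real^'p) \<Rightarrow> nat \<Rightarrow> 'a \<Rightarrow> real^'p"
where
  "S_target n G \<gamma> x k \<omega> = G_mean n G (x k \<omega>) - \<gamma> k *\<^sub>R G_mean n G (x (k - 1) \<omega>)"

definition vfkm ::
  "'a measure \<Rightarrow> (nat \<Rightarrow> real) \<Rightarrow> (nat \<Rightarrow> real) \<Rightarrow> real^'p
    \<Rightarrow> (nat \<Rightarrow> 'a \<Rightarrow> real^'p) \<Rightarrow> (nat \<Rightarrow> 'a \<Rightarrow> real^'p) \<Rightarrow> bool"
where
  "vfkm M \<theta> \<eta> x0 St x \<longleftrightarrow>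
    (\<forall>\<omega>\<in>space M.
      x 0 \<omega> = x0 \<and>
      (\<forall>k. x (k + 1) \<omega> = x k \<omega> + \<theta> k *\<^sub>R (x k \<omega> - x (k - 1) \<omega>) - \<eta> k *\<^sub>R St k \<omega>))"

text \<open>\<open>coin k \<omega>\<close> is the outcome of the Bernoulli switch: true means that the snapshot is refreshed.\<close>

definition svrg_snapshots ::
  "'a measure \<Rightarrow> (nat \<Rightarrow> 'a \<Rightarrow> bool) \<Rightarrow> (nat \<Rightarrow> 'a \<Rightarrow> real^'p) \<Rightarrow> (nat \<Rightarrow> 'a \<Rightarrow> real^'p) \<Rightarrow> bool"
where
  "svrg_snapshots M coin x w \<longleftrightarrow>
    (\<forall>\<omega>\<in>space M.
      w 0 \<omega> = x 0 \<omega> \<and>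
      (\<forall>k\<ge>1. w k \<omega> = (if coin k \<omega> then x (k - 1) \<omega> else w (k - 1) \<omega>)))"

definition svrg_estimator ::
  "'a measure \<Rightarrow> nat \<Rightarrow> (nat \<Rightarrow> real^'p \<Rightarrow> real^'p) \<Rightarrow> (nat \<Rightarrow> real) \<Rightarrow> (nat \<Rightarrow> 'a \<Rightarrow> nat list)
    \<Rightarrow> (nat \<Rightarrow> 'a \<Rightarrow> real^'p) \<Rightarrow> (nat \<Rightarrow> 'a \<Rightarrow> real^'p) \<Rightarrow> (nat \<Rightarrow> 'a \<Rightarrow> real^'p) \<Rightarrow> bool"
where
  "svrg_estimator M n G \<gamma> batch x w St \<longleftrightarrow>
    (\<forall>\<omega>\<in>space M.
      St 0 \<omega> = S_target n G \<gamma> x 0 \<omega> \<and>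
      (\<forall>k\<ge>1. St k \<omega> =
        (1 - \<gamma> k) *\<^sub>R (G_mean n G (w k \<omega>) - G_batch G (batch k \<omega>) (w k \<omega>))
        + G_batch G (batch k \<omega>) (x k \<omega>) - \<gamma> k *\<^sub>R G_batch G (batch k \<omega>) (x (k - 1) \<omega>)))"

definition draw_algebra ::
  "'a measure \<Rightarrow> (nat \<Rightarrow> 'a \<Rightarrow> bool) \<Rightarrow> (nat \<Rightarrow> 'a \<Rightarrow> nat list) \<Rightarrow> nat \<Rightarrow> 'a measure"
where
  "draw_algebra M coin batch k =
    vimage_algebra (space M) (\<lambda>\<omega>. (coin k \<omega>, batch k \<omega>)) (count_space UNIV)"

text \<open>
  The starting point is deterministic and no sampling takes place at iteration 0, so the
  randomness preceding the draws of iteration \<open>k\<close> consists of the draws of iterations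
  \<open>1, \<dots>, k - 1\<close>.
\<close>

definition history ::
  "'a measure \<Rightarrow> (nat \<Rightarrow> 'a \<Rightarrow> bool) \<Rightarrow> (nat \<Rightarrow> 'a \<Rightarrow> nat list) \<Rightarrow> nat \<Rightarrow> 'a measure"
where
  "history M coin batch k = sigma (space M) (\<Union>i\<in>{1..<k}. sets (draw_algebra M coin batch i))"

definition svrg_sampling ::
  "'a measure \<Rightarrow> nat \<Rightarrow> nat \<Rightarrow> real \<Rightarrow> (nat \<Rightarrow> 'a \<Rightarrow> bool) \<Rightarrow> (nat \<Rightarrow> 'a \<Rightarrow> nat list) \<Rightarrow> bool"
where
  "svrg_sampling M n b q coin batch \<longleftrightarrow>
    (\<forall>k\<ge>1.
      coin k \<in> measurable M (count_space UNIV) \<and>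
      distr M (count_space UNIV) (coin k) = measure_pmf (bernoulli_pmf q) \<and>
      batch k \<in> measurable M (count_space UNIV) \<and>
      distr M (count_space UNIV) (batch k) = measure_pmf (replicate_pmf b (pmf_of_set {1..n})) \<and>
      prob_space.indep_set M
        (sets (vimage_algebra (space M) (coin k) (count_space UNIV)))
        (sets (vimage_algebra (space M) (batch k) (count_space UNIV))) \<and>
      prob_space.indep_set M (sets (history M coin batch k)) (sets (draw_algebra M coin batch k)))"

text \<open>
  The library provides conditional expectations of real functions only; for vectors they are
  taken componentwise.
\<close>

definition vec_cond_exp :: "'a measure \<Rightarrow> 'a measure \<Rightarrow> ('a \<Rightarrow> real^'p) \<Rightarrow> 'a \<Rightarrow> real^'p" where
  "vec_cond_exp M F f \<omega> = (\<chi> j. real_cond_exp M F (\<lambda>\<omega>'. f \<omega>' $ j) \<omega>)"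

text \<open>
  The integrability clauses guarantee that the conditional expectations below are meaningful:
  \<^const>\<open>real_cond_exp\<close> is a total function with unspecified meaning on non-integrable arguments.
\<close>

definition vr_unbiased_with ::
  "'a measure \<Rightarrow> (nat \<Rightarrow> 'a measure) \<Rightarrow> (nat \<Rightarrow> real) \<Rightarrow> (nat \<Rightarrow> 'a \<Rightarrow> real^'p) \<Rightarrow> (nat \<Rightarrow> 'a \<Rightarrow> real^'p)
    \<Rightarrow> (nat \<Rightarrow> 'a \<Rightarrow> real) \<Rightarrow> real \<Rightarrow> real \<Rightarrow> real \<Rightarrow> (nat \<Rightarrow> 'a \<Rightarrow> real) \<Rightarrow> bool"
where
  "vr_unbiased_with M F \<gamma> S St U \<rho> \<Theta> \<Theta>' \<Delta> \<longleftrightarrow>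
    0 < \<rho> \<and> \<rho> < 1 \<and> 0 < \<Theta> \<and> 0 \<le> \<Theta>' \<and>
    (\<forall>k. \<Delta> k \<in> borel_measurable M \<and> (\<forall>\<omega>\<in>space M. 0 \<le> \<Delta> k \<omega>)) \<and>
    (\<forall>k\<ge>1.
      integrable M (\<lambda>\<omega>. St k \<omega> - S k \<omega>) \<and>
      integrable M (\<lambda>\<omega>. (norm (St k \<omega> - S k \<omega>))\<^sup>2) \<and>
      integrable M (\<Delta> k) \<and>
      (AE \<omega> in M. vec_cond_exp M (F k) (\<lambda>\<omega>. St k \<omega> - S k \<omega>) \<omega> = 0) \<and>
      (AE \<omega> in M. real_cond_exp M (F k) (\<lambda>\<omega>. (norm (St k \<omega> - S k \<omega>))\<^sup>2) \<omega>
                    \<le> real_cond_exp M (F k) (\<Delta> k) \<omega>) \<and>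
      (AE \<omega> in M. 1 / (1 - \<gamma> k)\<^sup>2 * real_cond_exp M (F k) (\<Delta> k) \<omega>
                    \<le> (1 - \<rho>) / (1 - \<gamma> (k - 1))\<^sup>2 * \<Delta> (k - 1) \<omega>
                      + \<Theta> / (1 - \<gamma> k)\<^sup>2 * U k \<omega>
                      + \<Theta>' / (1 - \<gamma> (k - 1))\<^sup>2 * U (k - 1) \<omega>))"

definition vr_unbiased_estimator ::
  "'a measure \<Rightarrow> (nat \<Rightarrow> 'a measure) \<Rightarrow> (nat \<Rightarrow> real) \<Rightarrow> (nat \<Rightarrow> 'a \<Rightarrow> real^'p) \<Rightarrow> (nat \<Rightarrow> 'a \<Rightarrow> real^'p)
    \<Rightarrow> (nat \<Rightarrow> 'a \<Rightarrow> real) \<Rightarrow> bool"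
where
  "vr_unbiased_estimator M F \<gamma> S St U \<longleftrightarrow>
    (\<exists>\<rho> \<Theta> \<Theta>' \<Delta>. vr_unbiased_with M F \<gamma> S St U \<rho> \<Theta> \<Theta>' \<Delta>)"

end

theory Submission
  imports Defs
begin

text \<open>
  Before iteration \<open>k\<close> draws anything, the method is in a state \<open>(x k, x (k - 1), w (k - 1))\<close> that
  is determined by the past draws, and the fresh draw (coin, mini-batch) is independent of that
  past. Conditioning on the history therefore freezes the state and averages over the draw only
  (\<open>cond_exp_fun\<close>); all three claims become statements about the fixed finite distribution of one
  draw. The maps \<open>G i\<close> are arbitrary functions, so the state is a random variable with values in a
  discrete space, where every function of it is measurable. It takes finitely many values almost
  surely, which settles all questions of integrability.

  With the residuals \<open>y i = G i x - \<gamma> G i x' - (1 - \<gamma>) G i w\<close>, where \<open>x'\<close> precedes \<open>x\<close> and \<open>w\<close> is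
  the new snapshot, the estimation error is the mini-batch mean of the \<open>y i\<close> minus their full mean.
  Given the coin, it is centred, and its second moment is the variance of the \<open>y i\<close> divided by \<open>b\<close>,
  hence at most \<open>1 / (n b)\<close> times the sum of their squared norms, which is \<open>\<Delta>\<close>
  (\<open>batch_mean_deviation\<close>).

  For the recursion, average over the coin. If the snapshot is refreshed, the residuals are just
  the increments \<open>G i x - G i x'\<close>. Otherwise the old snapshot stays, and
  \<open>y i / (1 - \<gamma>)\<close> is \<open>G i x' - G i w\<close> plus a scaled increment, while \<open>G i x' - G i w\<close> is the scaled
  residual of the previous iteration plus a scaled previous increment. Two applications of Young's
  inequality give the claim (\<open>residual_recursion\<close>); the probability \<open>1 - q\<close> of this case leaves
  enough room for the contraction factor \<open>1 - q / 2\<close>.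
\<close>

section \<open>Conditional expectation given the past of a fresh discrete draw\<close>

lemma AE_in_set_pmf:
  assumes "Y \<in> measurable M (count_space UNIV)" "distr M (count_space UNIV) Y = measure_pmf P"
  shows "AE \<omega> in M. Y \<omega> \<in> set_pmf P"
proof -
  have "AE e in distr M (count_space UNIV) Y. e \<in> set_pmf P"
    unfolding assms(2) by (simp add: AE_measure_pmf)
  then show ?thesis
    by (subst (asm) AE_distr_iff[OF assms(1)]) auto
qed

lemma measurable_fun_countable:
  fixes Y :: "'a \<Rightarrow> 'e::countable"
  assumes "X \<in> measurable N (count_space UNIV)" "Y \<in> measurable N (count_space UNIV)"
  shows "(\<lambda>\<omega>. f (X \<omega>) (Y \<omega>)) \<in> measurable N (count_space UNIV)"
  by (rule measurable_compose_countable[OF _ assms(2)]) (rule measurable_compose[OF assms(1)], simp)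

text \<open>
  A finitely valued state \<open>X\<close> known to \<open>F\<close> is combined with a draw \<open>Y\<close> independent of \<open>F\<close>. The state
  is measurable into the discrete space over its whole, possibly uncountable, type: this makes
  every function of the state measurable.
\<close>

locale fresh_draw = prob_space M for M :: "'a measure" +
  fixes F :: "'a measure"
    and X :: "'a \<Rightarrow> 's"
    and Y :: "'a \<Rightarrow> 'e::countable"
    and P :: "'e pmf"
    and A :: "'s set"
  assumes subalg: "subalgebra M F"
    and X_meas: "X \<in> measurable F (count_space UNIV)"
    and finite_A: "finite A"
    and AE_X: "AE \<omega> in M. X \<omega> \<in> A"
    and Y_meas: "Y \<in> measurable M (count_space UNIV)"
    and Y_distr: "distr M (count_space UNIV) Y = measure_pmf P"
    and finite_P: "finite (set_pmf P)"
    and indep: "indep_set (sets F) (sets (vimage_algebra (space M) Y (count_space UNIV)))"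
begin

sublocale finite_measure_subalgebra M F
  by unfold_locales (rule subalg)

lemma X_meas_M: "X \<in> measurable M (count_space UNIV)"
  by (rule measurable_from_subalg[OF subalg X_meas])

lemma AE_Y: "AE \<omega> in M. Y \<omega> \<in> set_pmf P"
  by (rule AE_in_set_pmf[OF Y_meas Y_distr])

lemma prob_Y: "prob (Y -` {e} \<inter> space M) = pmf P e"
  using measure_distr[OF Y_meas, of "{e}"] unfolding Y_distr by (simp add: pmf.rep_eq)

lemma measurable_fun:
  assumes "\<And>\<omega>. \<omega> \<in> space M \<Longrightarrow> Z \<omega> = f (X \<omega>) (Y \<omega>)"
  shows "Z \<in> measurable M (count_space UNIV)"
  using measurable_fun_countable[OF X_meas_M Y_meas, of f] by (subst measurable_cong[OF assms])

lemma AE_fun: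
  assumes "\<And>\<omega>. \<omega> \<in> space M \<Longrightarrow> Z \<omega> = f (X \<omega>) (Y \<omega>)"
  shows "AE \<omega> in M. Z \<omega> \<in> case_prod f ` (A \<times> set_pmf P)"
  using AE_X AE_Y AE_space
proof eventually_elim
  case (elim \<omega>)
  then have "Z \<omega> = case_prod f (X \<omega>, Y \<omega>)" "(X \<omega>, Y \<omega>) \<in> A \<times> set_pmf P"
    using assms by auto
  then show ?case by (rule image_eqI)
qed

lemma integrable_fun:
  fixes f :: "'s \<Rightarrow> 'e \<Rightarrow> 'c::{banach, second_countable_topology}"
  assumes "\<And>\<omega>. \<omega> \<in> space M \<Longrightarrow> Z \<omega> = f (X \<omega>) (Y \<omega>)"
  shows "integrable M Z"
proof (rule integrable_const_bound)
  let ?R = "norm ` case_prod f ` (A \<times> set_pmf P)"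
  show "AE \<omega> in M. norm (Z \<omega>) \<le> Max ?R"
    by (rule eventually_mono[OF AE_fun[of Z f, OF assms]])
      (assumption, auto intro!: Max_ge simp: finite_A finite_P)
  show "Z \<in> borel_measurable M"
    by (rule measurable_compose[OF measurable_fun[of Z f, OF assms], of "\<lambda>z. z"]) simp_all
qed

lemma cond_exp_indicator_draw:
  "AE \<omega> in M. real_cond_exp M F (indicator (Y -` {e} \<inter> space M)) \<omega> = pmf P e"
proof (rule real_cond_exp_charact)
  let ?B = "Y -` {e} \<inter> space M"
  have B [measurable]: "?B \<in> sets M"
    by (rule measurable_sets[OF Y_meas]) simp
  show "integrable M (indicator ?B :: 'a \<Rightarrow> real)"
    using B by (simp add: integrable_indicator_iff emeasure_eq_measure)
  fix C assume C: "C \<in> sets F"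
  then have CM [measurable]: "C \<in> sets M"
    using subalg by (auto simp: subalgebra_def)
  have "prob (C \<inter> ?B) = prob C * prob ?B"
    by (rule indep_setD[OF indep C]) (rule in_vimage_algebra, simp)
  moreover have "set_lebesgue_integral M C (indicator ?B) = prob (C \<inter> ?B)"
    unfolding set_lebesgue_integral_def
    by (simp add: indicator_inter_arith[symmetric] B CM sets.Int)
  moreover have "set_lebesgue_integral M C (\<lambda>_. pmf P e) = prob C * pmf P e"
    unfolding set_lebesgue_integral_def using CM by simp
  ultimately show "set_lebesgue_integral M C (indicator ?B) = set_lebesgue_integral M C (\<lambda>_. pmf P e)"
    by (simp add: prob_Y)
qed simp_all

text \<open>
  The finite support of the draw turns \<open>f X Y\<close> into a finite sum of \<open>F\<close>-measurable factors times
  indicators of the values of \<open>Y\<close>; the factors leave the conditional expectation, and independence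
  turns the indicators into probabilities.
\<close>

theorem cond_exp_fun:
  fixes f :: "'s \<Rightarrow> 'e \<Rightarrow> real"
  assumes Z: "\<And>\<omega>. \<omega> \<in> space M \<Longrightarrow> Z \<omega> = f (X \<omega>) (Y \<omega>)"
  shows "AE \<omega> in M. real_cond_exp M F Z \<omega> = (LINT e|P. f (X \<omega>) e)"
proof -
  define I :: "'e \<Rightarrow> 'a \<Rightarrow> real" where "I e = indicator (Y -` {e} \<inter> space M)" for e
  have I_eq: "I e \<omega> = of_bool (Y \<omega> = e)" if "\<omega> \<in> space M" for e \<omega>
    using that by (auto simp: I_def indicator_def)
  have int: "integrable M (\<lambda>\<omega>. f (X \<omega>) e * I e \<omega>)" for e
    by (rule integrable_fun[where f = "\<lambda>a e'. f a e * of_bool (e' = e)"]) (simp add: I_eq)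
  have I_int: "integrable M (I e)" for e
    by (rule integrable_fun[where f = "\<lambda>a e'. of_bool (e' = e)"]) (simp add: I_eq)
  have fX: "(\<lambda>\<omega>. f (X \<omega>) e) \<in> borel_measurable F" for e
    by (rule measurable_compose[OF X_meas]) simp
  have "AE \<omega> in M. Z \<omega> = (\<Sum>e\<in>set_pmf P. f (X \<omega>) e * I e \<omega>)"
    using AE_Y AE_space
  proof eventually_elim
    case (elim \<omega>)
    have "(\<Sum>e\<in>set_pmf P. f (X \<omega>) e * I e \<omega>) = (\<Sum>e\<in>set_pmf P. if e = Y \<omega> then f (X \<omega>) e else 0)"
      using elim by (intro sum.cong) (auto simp: I_eq)
    with elim show ?case by (simp add: Z finite_P)
  qed
  then have 1: "AE \<omega> in M. real_cond_exp M F Z \<omega>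
      = real_cond_exp M F (\<lambda>\<omega>. \<Sum>e\<in>set_pmf P. f (X \<omega>) e * I e \<omega>) \<omega>"
    by (rule real_cond_exp_cong)
      (auto intro!: borel_measurable_integrable integrable_fun[of Z f, OF Z] int Bochner_Integration.integrable_sum)
  have 2: "AE \<omega> in M. real_cond_exp M F (\<lambda>\<omega>. \<Sum>e\<in>set_pmf P. f (X \<omega>) e * I e \<omega>) \<omega>
      = (\<Sum>e\<in>set_pmf P. real_cond_exp M F (\<lambda>\<omega>. f (X \<omega>) e * I e \<omega>) \<omega>)"
    by (rule real_cond_exp_sum) (rule int)
  have 3: "AE \<omega> in M. \<forall>e\<in>set_pmf P. real_cond_exp M F (\<lambda>\<omega>. f (X \<omega>) e * I e \<omega>) \<omega>
      = f (X \<omega>) e * real_cond_exp M F (I e) \<omega>"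
    by (rule AE_finite_allI[OF finite_P])
      (rule real_cond_exp_mult[OF fX borel_measurable_integrable[OF I_int] int])
  have 4: "AE \<omega> in M. \<forall>e\<in>set_pmf P. real_cond_exp M F (I e) \<omega> = pmf P e"
    unfolding I_def by (rule AE_finite_allI[OF finite_P]) (rule cond_exp_indicator_draw)
  from 1 2 3 4 show ?thesis
  proof eventually_elim
    case (elim \<omega>)
    have "(LINT e|P. f (X \<omega>) e) = (\<Sum>e\<in>set_pmf P. pmf P e * f (X \<omega>) e)"
      by (subst integral_measure_pmf[OF finite_P]) auto
    with elim show ?case by (simp add: mult.commute)
  qed
qed

end

section \<open>Mean and variance of a mini-batch\<close>

lemma expectation_bind_pmf_finite:
  fixes h :: "'b \<Rightarrow> 'c::{banach, second_countable_topology}"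
  assumes "finite (set_pmf p)" "\<And>x. x \<in> set_pmf p \<Longrightarrow> finite (set_pmf (f x))"
  shows "(LINT y|bind_pmf p f. h y) = (LINT x|p. LINT y|f x. h y)"
  using assms
  by (subst pmf_expectation_bind[of "set_pmf p"], simp_all)
     (subst integral_measure_pmf[of "set_pmf p"], simp_all)

lemma finite_set_replicate_pmf:
  "finite (set_pmf p) \<Longrightarrow> finite (set_pmf (replicate_pmf b p))"
  by (simp add: set_replicate_pmf finite_lists_length_eq lists_eq_set)

lemma expectation_replicate_pmf_Suc:
  fixes h :: "'i list \<Rightarrow> 'c::{banach, second_countable_topology}"
  assumes "finite (set_pmf p)"
  shows "(LINT B|replicate_pmf (Suc b) p. h B) = (LINT i|p. LINT B|replicate_pmf b p. h (i # B))"
  using assms by (simp add: expectation_bind_pmf_finite finite_set_replicate_pmf)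

lemma expectation_batch_sum:
  fixes z :: "'i \<Rightarrow> 'c::{banach, second_countable_topology}"
  assumes "finite (set_pmf p)"
  shows "(LINT B|replicate_pmf b p. (\<Sum>i\<leftarrow>B. z i)) = real b *\<^sub>R (LINT i|p. z i)"
proof (induction b)
  case (Suc b)
  have [simp]: "integrable (replicate_pmf b p) h" "integrable p h'"
    for h :: "'i list \<Rightarrow> 'c" and h' :: "'i \<Rightarrow> 'c"
    using assms by (auto intro!: integrable_measure_pmf_finite finite_set_replicate_pmf)
  show ?case
    using assms by (simp add: expectation_replicate_pmf_Suc Suc scaleR_left_distrib del: replicate_pmf.simps)
qed simp

text \<open>
  The draws of a batch are independent and centred, so the cross terms vanish and the second
  moments add up.
\<close>

lemma expectation_norm_batch_sum:
  fixes z :: "'i \<Rightarrow> 'c::euclidean_space"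
  assumes fin: "finite (set_pmf p)" and mean: "(LINT i|p. z i) = 0"
  shows "(LINT B|replicate_pmf b p. (norm (\<Sum>i\<leftarrow>B. z i))\<^sup>2) = real b * (LINT i|p. (norm (z i))\<^sup>2)"
proof (induction b)
  case (Suc b)
  have [simp]: "integrable (replicate_pmf b p) h" "integrable p h'"
    for h :: "'i list \<Rightarrow> 'd::{banach, second_countable_topology}" and h' :: "'i \<Rightarrow> 'd"
    using fin by (auto intro!: integrable_measure_pmf_finite finite_set_replicate_pmf)
  have cross: "(LINT B|replicate_pmf b p. z i \<bullet> (\<Sum>j\<leftarrow>B. z j)) = 0" for i
    by (subst integral_inner_right) (simp_all add: expectation_batch_sum[OF fin] mean)
  have expand: "(norm (z i + s))\<^sup>2 = (norm (z i))\<^sup>2 + 2 * (z i \<bullet> s) + (norm s)\<^sup>2" for i s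
    by (simp add: power2_norm_eq_inner inner_add inner_commute)
  show ?case
    by (simp add: expectation_replicate_pmf_Suc[OF fin] expand Suc cross distrib_right
        del: replicate_pmf.simps)
qed simp

text \<open>The variance is the second moment minus the squared norm of the mean.\<close>

lemma expectation_norm_deviation_le:
  fixes y :: "'i \<Rightarrow> 'c::euclidean_space"
  assumes fin: "finite (set_pmf p)"
  shows "(LINT i|p. (norm (y i - (LINT j|p. y j)))\<^sup>2) \<le> (LINT i|p. (norm (y i))\<^sup>2)"
proof -
  have [simp]: "integrable p h" for h :: "'i \<Rightarrow> 'd::{banach, second_countable_topology}"
    using fin by (rule integrable_measure_pmf_finite)
  define m where "m = (LINT j|p. y j)"
  have "(norm (y i - m))\<^sup>2 = (norm (y i))\<^sup>2 - 2 * (y i \<bullet> m) + (norm m)\<^sup>2" for i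
    by (simp add: power2_norm_eq_inner inner_diff inner_commute)
  then have "(LINT i|p. (norm (y i - m))\<^sup>2)
      = (LINT i|p. (norm (y i))\<^sup>2) - 2 * (LINT i|p. y i \<bullet> m) + (norm m)\<^sup>2"
    by simp
  also have "(LINT i|p. y i \<bullet> m) = (norm m)\<^sup>2"
    by (simp add: m_def power2_norm_eq_inner)
  finally show ?thesis by (simp add: m_def)
qed

lemma batch_mean_deviation:
  fixes y :: "'i \<Rightarrow> 'c::euclidean_space"
  assumes fin: "finite (set_pmf p)" and b: "b \<ge> 1"
  defines "D \<equiv> \<lambda>B. (1 / real (length B)) *\<^sub>R (\<Sum>i\<leftarrow>B. y i) - (LINT i|p. y i)"
  shows "(LINT B|replicate_pmf b p. D B) = 0"
    and "(LINT B|replicate_pmf b p. (norm (D B))\<^sup>2) \<le> (LINT i|p. (norm (y i))\<^sup>2) / real b"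
proof -
  have [simp]: "integrable p h" for h :: "'i \<Rightarrow> 'd::{banach, second_countable_topology}"
    using fin by (rule integrable_measure_pmf_finite)
  define z where "z i = y i - (LINT j|p. y j)" for i
  have mean: "(LINT i|p. z i) = 0"
    by (simp add: z_def)
  have z_sum: "(\<Sum>i\<leftarrow>B. z i) = (\<Sum>i\<leftarrow>B. y i) - real (length B) *\<^sub>R (LINT j|p. y j)" for B
    by (induction B) (simp_all add: z_def algebra_simps)
  have D: "D B = (1 / real b) *\<^sub>R (\<Sum>i\<leftarrow>B. z i)" if "B \<in> set_pmf (replicate_pmf b p)" for B
    using that b by (simp add: set_replicate_pmf D_def z_sum algebra_simps)
  have "(LINT B|replicate_pmf b p. D B) = (LINT B|replicate_pmf b p. (1 / real b) *\<^sub>R (\<Sum>i\<leftarrow>B. z i))"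
    by (intro integral_cong_AE) (simp_all add: AE_measure_pmf_iff D)
  then show "(LINT B|replicate_pmf b p. D B) = 0"
    by (simp add: expectation_batch_sum[OF fin] mean)
  have "(LINT B|replicate_pmf b p. (norm (D B))\<^sup>2)
      = (LINT B|replicate_pmf b p. (1 / real b)\<^sup>2 * (norm (\<Sum>i\<leftarrow>B. z i))\<^sup>2)"
    by (intro integral_cong_AE) (simp_all add: AE_measure_pmf_iff D power_mult_distrib power_divide)
  also have "\<dots> = (LINT i|p. (norm (z i))\<^sup>2) / real b"
    using b by (simp add: expectation_norm_batch_sum[OF fin mean] power_divide)
      (simp add: power2_eq_square)
  also have "\<dots> \<le> (LINT i|p. (norm (y i))\<^sup>2) / real b"
    unfolding z_def by (intro divide_right_mono expectation_norm_deviation_le fin) simp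
  finally show "(LINT B|replicate_pmf b p. (norm (D B))\<^sup>2) \<le> (LINT i|p. (norm (y i))\<^sup>2) / real b" .
qed

section \<open>The recursion for a single component\<close>

text \<open>Young's inequality: expand \<open>0 \<le> (norm (s *\<^sub>R a - c))\<^sup>2 / s\<close>.\<close>

lemma norm_add_sq_le:
  fixes a c :: "'v::real_inner"
  assumes "s > 0"
  shows "(norm (a + c))\<^sup>2 \<le> (1 + s) * (norm a)\<^sup>2 + (1 + 1 / s) * (norm c)\<^sup>2"
proof -
  have "0 \<le> (norm (s *\<^sub>R a - c))\<^sup>2 / s"
    using assms by simp
  also have "(norm (s *\<^sub>R a - c))\<^sup>2 / s = s * (norm a)\<^sup>2 - 2 * (a \<bullet> c) + (norm c)\<^sup>2 / s"
    using assms unfolding power2_norm_eq_inner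
    by (simp add: inner_diff inner_commute field_simps)
  finally show ?thesis
    by (simp add: power2_norm_eq_inner inner_add inner_commute algebra_simps)
qed

text \<open>
  Here \<open>u\<close>, \<open>u'\<close>, \<open>u''\<close> and \<open>v\<close> stand for the values of one \<open>G i\<close> at the current, the previous and
  the last but one iterate and at the old snapshot, and \<open>g\<close>, \<open>g'\<close> for the current and the previous
  \<open>\<gamma>\<close>. The left-hand side averages the new squared residual over the coin.
\<close>

lemma residual_recursion:
  fixes u u' u'' v :: "'v::real_inner"
  assumes q: "0 < q" "q < 1" and g: "g < 1" and g': "g' < 1"
  shows "(q * (norm (u - g *\<^sub>R u' - (1 - g) *\<^sub>R u'))\<^sup>2
            + (1 - q) * (norm (u - g *\<^sub>R u' - (1 - g) *\<^sub>R v))\<^sup>2) / (1 - g)\<^sup>2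
    \<le> (1 - q / 2) / (1 - g')\<^sup>2 * (norm (u' - g' *\<^sub>R u'' - (1 - g') *\<^sub>R v))\<^sup>2
      + (4 - 6 * q + 3 * q\<^sup>2) / (q * (1 - g)\<^sup>2) * (norm (u - u'))\<^sup>2
      + 2 * (2 - 3 * q + q\<^sup>2) * g'\<^sup>2 / (q * (1 - g')\<^sup>2) * (norm (u' - u''))\<^sup>2"
proof -
  \<comment> \<open>The Young parameters: \<open>s\<close> splits off the current increment, \<open>t\<close> the previous one. They are
    determined by requiring \<open>(1 - q) * (1 + s) * (1 + t) = 1 - q / 2\<close> and
    \<open>(1 - q) * (1 + s) * (1 + 1 / t) = 2 * (1 - q) * (2 - q) / q\<close>.\<close>
  define s where "s = q / (4 - 3 * q)"
  define t where "t = q / (4 * (1 - q))"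
  have s: "s > 0" and t: "t > 0"
    using q by (auto simp: s_def t_def)
  define c where "c = 1 - g"
  define c' where "c' = 1 - g'"
  have c: "c > 0" "c' > 0" using g g' by (auto simp: c_def c'_def)
  define d where "d = (norm (u - u'))\<^sup>2 / c\<^sup>2"
  define d' where "d' = g'\<^sup>2 * (norm (u' - u''))\<^sup>2 / c'\<^sup>2"
  define r where "r = (norm (u' - g' *\<^sub>R u'' - c' *\<^sub>R v))\<^sup>2 / c'\<^sup>2"
  have "(norm ((1 / c) *\<^sub>R (u - g *\<^sub>R u' - c *\<^sub>R v)))\<^sup>2
      \<le> (1 + s) * (norm (u' - v))\<^sup>2 + (1 + 1 / s) * (norm ((1 / c) *\<^sub>R (u - u')))\<^sup>2"
  proof -
    have "(1 / c) *\<^sub>R (u - g *\<^sub>R u' - c *\<^sub>R v) = (1 / c) *\<^sub>R (c *\<^sub>R (u' - v) + (u - u'))"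
      by (simp add: c_def algebra_simps)
    also have "\<dots> = (u' - v) + (1 / c) *\<^sub>R (u - u')"
      using c by (simp add: scaleR_add_right)
    finally show ?thesis
      using norm_add_sq_le[OF s, of "u' - v" "(1 / c) *\<^sub>R (u - u')"] by simp
  qed
  then have 1: "(norm (u - g *\<^sub>R u' - c *\<^sub>R v))\<^sup>2 / c\<^sup>2 \<le> (1 + s) * (norm (u' - v))\<^sup>2 + (1 + 1 / s) * d"
    by (simp add: d_def power_mult_distrib power_divide)
  have "(norm (u' - v))\<^sup>2 \<le> (1 + t) * (norm ((1 / c') *\<^sub>R (u' - g' *\<^sub>R u'' - c' *\<^sub>R v)))\<^sup>2
      + (1 + 1 / t) * (norm ((- g' / c') *\<^sub>R (u' - u'')))\<^sup>2"
  proof -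
    have "c' *\<^sub>R (u' - v) = (u' - g' *\<^sub>R u'' - c' *\<^sub>R v) + (- g') *\<^sub>R (u' - u'')"
      by (simp add: c'_def algebra_simps)
    then have "(1 / c') *\<^sub>R c' *\<^sub>R (u' - v)
        = (1 / c') *\<^sub>R ((u' - g' *\<^sub>R u'' - c' *\<^sub>R v) + (- g') *\<^sub>R (u' - u''))"
      by (rule arg_cong)
    then have "u' - v = (1 / c') *\<^sub>R (u' - g' *\<^sub>R u'' - c' *\<^sub>R v) + (- g' / c') *\<^sub>R (u' - u'')"
      using c by (simp add: scaleR_diff_right)
    then show ?thesis
      using norm_add_sq_le[OF t] by metis
  qed
  then have 2: "(norm (u' - v))\<^sup>2 \<le> (1 + t) * r + (1 + 1 / t) * d'"
    by (simp add: r_def d'_def power_mult_distrib power_divide)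
  have same: "u - g *\<^sub>R u' - c *\<^sub>R u' = u - u'"
    by (simp add: c_def algebra_simps)
  have "(q * (norm (u - g *\<^sub>R u' - c *\<^sub>R u'))\<^sup>2 + (1 - q) * (norm (u - g *\<^sub>R u' - c *\<^sub>R v))\<^sup>2) / c\<^sup>2
      = q * d + (1 - q) * ((norm (u - g *\<^sub>R u' - c *\<^sub>R v))\<^sup>2 / c\<^sup>2)"
    unfolding same by (simp add: d_def add_divide_distrib)
  also have "\<dots> \<le> q * d + (1 - q) * ((1 + s) * ((1 + t) * r + (1 + 1 / t) * d') + (1 + 1 / s) * d)"
  proof -
    have "(1 + s) * (norm (u' - v))\<^sup>2 \<le> (1 + s) * ((1 + t) * r + (1 + 1 / t) * d')"
      using 2 s by (intro mult_left_mono) auto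
    with 1 q show ?thesis by (intro add_left_mono mult_left_mono) auto
  qed
  also have "\<dots> = (1 - q) * (1 + s) * (1 + t) * r + (q + (1 - q) * (1 + 1 / s)) * d
      + (1 - q) * (1 + s) * (1 + 1 / t) * d'"
    by (simp only: distrib_left distrib_right mult.assoc add.assoc add.commute add.left_commute)
  also have "(1 - q) * (1 + s) * (1 + t) = 1 - q / 2"
  proof -
    have "1 + s = (4 - 2 * q) / (4 - 3 * q)" "1 + t = (4 - 3 * q) / (4 * (1 - q))"
      using q by (auto simp: s_def t_def field_simps)
    then have "(1 - q) * (1 + s) * (1 + t)
        = (1 - q) * ((4 - 2 * q) / (4 - 3 * q)) * ((4 - 3 * q) / (4 * (1 - q)))"
      by (simp only:)
    also have "\<dots> = (1 - q) * (4 - 2 * q) / (4 * (1 - q))"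
      using q by simp
    also have "\<dots> = 1 - q / 2"
      using q by (simp add: field_simps)
    finally show ?thesis .
  qed
  also have "q + (1 - q) * (1 + 1 / s) = (4 - 6 * q + 3 * q\<^sup>2) / q"
    using q by (simp add: s_def field_simps power2_eq_square)
  also have "(1 - q) * (1 + s) * (1 + 1 / t) = 2 * (2 - 3 * q + q\<^sup>2) / q"
  proof -
    have "1 + s = (4 - 2 * q) / (4 - 3 * q)" "1 + 1 / t = (4 - 3 * q) / q"
      using q by (auto simp: s_def t_def field_simps)
    then have "(1 - q) * (1 + s) * (1 + 1 / t) = (1 - q) * (4 - 2 * q) / q"
      using q by simp
    also have "\<dots> = 2 * (2 - 3 * q + q\<^sup>2) / q"
      by (simp add: algebra_simps power2_eq_square)
    finally show ?thesis .
  qed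
  finally show ?thesis
    by (simp add: d_def d'_def r_def c_def c'_def)
qed

section \<open>The estimation error as the deviation of a mini-batch mean\<close>

lemma expectation_pair_pmf_finite:
  fixes h :: "'i \<times> 'j \<Rightarrow> 'c::{banach, second_countable_topology}"
  assumes "finite (set_pmf p)" "finite (set_pmf r)"
  shows "(LINT e|pair_pmf p r. h e) = (LINT i|p. LINT j|r. h (i, j))"
  using assms by (simp add: pair_pmf_def expectation_bind_pmf_finite)

lemma expectation_pmf_of_set:
  fixes h :: "'i \<Rightarrow> 'c::{banach, second_countable_topology}"
  assumes "finite I" "I \<noteq> {}"
  shows "(LINT i|pmf_of_set I. h i) = (1 / real (card I)) *\<^sub>R (\<Sum>i\<in>I. h i)"
  using assms by (subst integral_measure_pmf[of I]) (simp_all add: scaleR_sum_right)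

definition svrg_estimate ::
  "nat \<Rightarrow> (nat \<Rightarrow> real^'p \<Rightarrow> real^'p) \<Rightarrow> real \<Rightarrow> nat list \<Rightarrow> real^'p \<Rightarrow> real^'p \<Rightarrow> real^'p \<Rightarrow> real^'p"
where
  "svrg_estimate n G g B u u' v =
    (1 - g) *\<^sub>R (G_mean n G v - G_batch G B v) + G_batch G B u - g *\<^sub>R G_batch G B u'"

definition residual ::
  "(nat \<Rightarrow> real^'p \<Rightarrow> real^'p) \<Rightarrow> real \<Rightarrow> real^'p \<Rightarrow> real^'p \<Rightarrow> real^'p \<Rightarrow> nat \<Rightarrow> real^'p"
where
  "residual G g u u' v i = G i u - g *\<^sub>R G i u' - (1 - g) *\<^sub>R G i v"

text \<open>
  The estimate is affine in the batch means, and the snapshot correction \<open>(1 - g) *\<^sub>R (G v - G_B v)\<close>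
  makes the batch mean at \<open>v\<close> enter with the weight that \<open>G i v\<close> has in the residual.
\<close>

lemma svrg_estimate_error:
  assumes "n \<ge> 1"
  shows "svrg_estimate n G g B u u' v - (G_mean n G u - g *\<^sub>R G_mean n G u')
    = (1 / real (length B)) *\<^sub>R (\<Sum>i\<leftarrow>B. residual G g u u' v i)
      - (LINT i|pmf_of_set {1..n}. residual G g u u' v i)"
proof -
  have "(\<Sum>i\<leftarrow>B. residual G g u u' v i)
      = (\<Sum>i\<leftarrow>B. G i u) - g *\<^sub>R (\<Sum>i\<leftarrow>B. G i u') - (1 - g) *\<^sub>R (\<Sum>i\<leftarrow>B. G i v)"
    by (induction B) (simp_all add: residual_def algebra_simps)
  then have "(1 / real (length B)) *\<^sub>R (\<Sum>i\<leftarrow>B. residual G g u u' v i)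
      = G_batch G B u - g *\<^sub>R G_batch G B u' - (1 - g) *\<^sub>R G_batch G B v"
    by (simp add: G_batch_def scaleR_diff_right mult.commute)
  moreover have "(LINT i|pmf_of_set {1..n}. residual G g u u' v i)
      = G_mean n G u - g *\<^sub>R G_mean n G u' - (1 - g) *\<^sub>R G_mean n G v"
    using assms
    by (simp add: expectation_pmf_of_set residual_def G_mean_def sum_subtractf
        scaleR_diff_right mult.commute flip: scaleR_sum_right)
  ultimately show ?thesis
    by (simp add: svrg_estimate_def scaleR_diff_right)
qed

section \<open>The method as a process driven by fresh draws\<close>

locale svrg = prob_space M for M :: "'a measure" +
  fixes G :: "nat \<Rightarrow> real^'p \<Rightarrow> real^'p"
    and n b :: nat
    and q :: real
    and \<gamma> \<theta> \<eta> :: "nat \<Rightarrow> real"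
    and x0 :: "real^'p"
    and coin :: "nat \<Rightarrow> 'a \<Rightarrow> bool"
    and batch :: "nat \<Rightarrow> 'a \<Rightarrow> nat list"
    and x w St :: "nat \<Rightarrow> 'a \<Rightarrow> real^'p"
  assumes n: "n \<ge> 1" and b: "b \<ge> 1"
    and q: "0 < q" "q < 1"
    and \<gamma>: "\<And>k. 0 \<le> \<gamma> k \<and> \<gamma> k < 1"
    and sampling: "svrg_sampling M n b q coin batch"
    and iteration: "vfkm M \<theta> \<eta> x0 St x"
    and snapshots: "svrg_snapshots M coin x w"
    and estimator: "svrg_estimator M n G \<gamma> batch x w St"
begin

abbreviation F :: "nat \<Rightarrow> 'a measure" where
  "F \<equiv> history M coin batch"

definition draw :: "nat \<Rightarrow> 'a \<Rightarrow> bool \<times> nat list" where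
  "draw k \<omega> = (coin k \<omega>, batch k \<omega>)"

definition batch_pmf :: "nat list pmf" where
  "batch_pmf = replicate_pmf b (pmf_of_set {1..n})"

definition draw_pmf :: "(bool \<times> nat list) pmf" where
  "draw_pmf = pair_pmf (bernoulli_pmf q) batch_pmf"

text \<open>
  The snapshot \<open>w k\<close> depends on the coin of iteration \<open>k\<close>; the state that is known before
  the draw contains the old snapshot \<open>w (k - 1)\<close>.
\<close>

definition state :: "nat \<Rightarrow> 'a \<Rightarrow> (real^'p) \<times> (real^'p) \<times> (real^'p)" where
  "state k \<omega> = (x k \<omega>, x (k - 1) \<omega>, w (k - 1) \<omega>)"

lemma finite_batch_pmf: "finite (set_pmf batch_pmf)"
  using n by (simp add: batch_pmf_def finite_set_replicate_pmf)

lemma finite_draw_pmf: "finite (set_pmf draw_pmf)"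
  by (simp add: draw_pmf_def finite_batch_pmf)

lemma measurable_draw_M:
  assumes "k \<ge> 1"
  shows "draw k \<in> measurable M (count_space UNIV)"
proof -
  have "coin k \<in> measurable M (count_space UNIV)" "batch k \<in> measurable M (count_space UNIV)"
    using sampling[unfolded svrg_sampling_def, rule_format, OF assms] by simp_all
  from measurable_fun_countable[OF this, of Pair] show ?thesis
    by (simp add: draw_def[abs_def])
qed

lemma draw_algebra_eq:
  "draw_algebra M coin batch k = vimage_algebra (space M) (draw k) (count_space UNIV)"
  by (simp add: draw_algebra_def draw_def[abs_def])

lemma distr_draw:
  assumes k: "k \<ge> 1"
  shows "distr M (count_space UNIV) (draw k) = measure_pmf draw_pmf"
proof (rule measure_eqI_countable[where A = UNIV])
  fix e :: "bool \<times> nat list"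
  obtain c B where e: "e = (c, B)" by (cases e)
  have coin: "coin k \<in> measurable M (count_space UNIV)"
      "distr M (count_space UNIV) (coin k) = measure_pmf (bernoulli_pmf q)"
    and batch: "batch k \<in> measurable M (count_space UNIV)"
      "distr M (count_space UNIV) (batch k) = measure_pmf batch_pmf"
    and indep: "indep_set (sets (vimage_algebra (space M) (coin k) (count_space UNIV)))
        (sets (vimage_algebra (space M) (batch k) (count_space UNIV)))"
    using sampling[unfolded svrg_sampling_def, rule_format, OF k]
    by (simp_all only: batch_pmf_def)
  have "draw k -` {e} \<inter> space M = (coin k -` {c} \<inter> space M) \<inter> (batch k -` {B} \<inter> space M)"
    by (intro set_eqI) (simp only: Int_iff vimage_eq singleton_iff draw_def e prod.inject, blast)
  then have "prob (draw k -` {e} \<inter> space M) = prob ((coin k -` {c} \<inter> space M) \<inter> (batch k -` {B} \<inter> space M))"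
    by (rule arg_cong)
  also have "\<dots> = prob (coin k -` {c} \<inter> space M) * prob (batch k -` {B} \<inter> space M)"
    by (rule indep_setD[OF indep]) (rule in_vimage_algebra, simp)+
  also have "prob (coin k -` {c} \<inter> space M) = pmf (bernoulli_pmf q) c"
    using measure_distr[OF coin(1), of "{c}"] by (simp add: coin(2) pmf.rep_eq)
  also have "prob (batch k -` {B} \<inter> space M) = pmf batch_pmf B"
    using measure_distr[OF batch(1), of "{B}"] by (simp add: batch(2) pmf.rep_eq)
  finally show "emeasure (distr M (count_space UNIV) (draw k)) {e} = emeasure draw_pmf {e}"
    by (simp add: emeasure_distr measurable_draw_M[OF k] emeasure_eq_measure emeasure_pmf_single
        draw_pmf_def pmf_pair e)
qed (simp_all add: emeasure_eq_measure emeasure_distr measurable_draw_M[OF k])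

lemma space_F [simp]: "space (F k) = space M"
  by (simp add: history_def space_measure_of_conv)

lemma sets_F:
  "sets (F k) = sigma_sets (space M) (\<Union>i\<in>{1..<k}. sets (draw_algebra M coin batch i))"
  unfolding history_def
proof (rule sets_measure_of, safe)
  fix C \<omega> i assume "C \<in> sets (draw_algebra M coin batch i)" "\<omega> \<in> C"
  then show "\<omega> \<in> space M"
    using sets.sets_into_space[of C "draw_algebra M coin batch i"] by (auto simp: draw_algebra_def)
qed

lemma subalgebra_F: "subalgebra M (F k)"
proof -
  have "sets (draw_algebra M coin batch i) \<subseteq> sets M" if "1 \<le> i" for i
    unfolding draw_algebra_eq by (rule sets_image_in_sets[OF _ measurable_draw_M[OF that]]) simp
  then have "sigma_sets (space M) (\<Union>i\<in>{1..<k}. sets (draw_algebra M coin batch i)) \<subseteq> sets M"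
    by (intro sets.sigma_sets_subset UN_least) simp
  then show ?thesis
    by (simp add: subalgebra_def sets_F)
qed

lemma measurable_draw_F:
  assumes "1 \<le> i" "i < k"
  shows "draw i \<in> measurable (F k) (count_space UNIV)"
proof (rule measurableI)
  fix C :: "(bool \<times> nat list) set"
  have "draw i -` C \<inter> space M \<in> sets (draw_algebra M coin batch i)"
    unfolding draw_algebra_eq by (rule in_vimage_algebra) simp
  then have "draw i -` C \<inter> space M \<in> (\<Union>i\<in>{1..<k}. sets (draw_algebra M coin batch i))"
    using assms by auto
  then show "draw i -` C \<inter> space (F k) \<in> sets (F k)"
    by (simp add: sets_F sigma_sets.Basic)
qed simp

lemma subalgebra_F_mono: "i \<le> k \<Longrightarrow> subalgebra (F k) (F i)"
  unfolding subalgebra_def sets_F by (intro conjI sigma_sets_mono' UN_mono) auto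

definition snapshot :: "bool \<Rightarrow> real^'p \<Rightarrow> real^'p \<Rightarrow> real^'p" where
  "snapshot c u' v = (if c then u' else v)"

lemma w_eq:
  assumes "k \<ge> 1" "\<omega> \<in> space M"
  shows "w k \<omega> = snapshot (coin k \<omega>) (x (k - 1) \<omega>) (w (k - 1) \<omega>)"
  using snapshots assms by (simp add: svrg_snapshots_def snapshot_def)

lemma St_eq:
  assumes "k \<ge> 1" "\<omega> \<in> space M"
  shows "St k \<omega> = svrg_estimate n G (\<gamma> k) (batch k \<omega>) (x k \<omega>) (x (k - 1) \<omega>) (w k \<omega>)"
  using estimator assms by (simp add: svrg_estimator_def svrg_estimate_def)

definition next_state where
  "next_state k = (\<lambda>(u, u', v) (c, B). let v' = snapshot c u' v in
     (u + \<theta> k *\<^sub>R (u - u') - \<eta> k *\<^sub>R svrg_estimate n G (\<gamma> k) B u u' v', u, v'))"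

lemma state_Suc:
  assumes "k \<ge> 1" "\<omega> \<in> space M"
  shows "state (Suc k) \<omega> = next_state k (state k \<omega>) (draw k \<omega>)"
proof -
  have "x (Suc k) \<omega> = x k \<omega> + \<theta> k *\<^sub>R (x k \<omega> - x (k - 1) \<omega>) - \<eta> k *\<^sub>R St k \<omega>"
    using iteration assms unfolding vfkm_def by simp
  then show ?thesis
    using assms by (simp add: state_def next_state_def draw_def Let_def St_eq w_eq)
qed

text \<open>
  Iteration 0 samples nothing and uses the exact value \<open>S_target\<close>, so the state before the first
  draw is deterministic.
\<close>

lemma state_1:
  "\<exists>s. \<forall>\<omega>\<in>space M. state 1 \<omega> = s"
proof (intro exI ballI)
  fix \<omega> assume \<omega>: "\<omega> \<in> space M"
  have "x 1 \<omega> = x0 - \<eta> 0 *\<^sub>R St 0 \<omega>" "x 0 \<omega> = x0"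
    using iteration \<omega> unfolding vfkm_def by (auto dest!: bspec spec[of _ 0])
  moreover have "w 0 \<omega> = x 0 \<omega>"
    using snapshots \<omega> by (simp add: svrg_snapshots_def)
  moreover have "St 0 \<omega> = G_mean n G (x 0 \<omega>) - \<gamma> 0 *\<^sub>R G_mean n G (x 0 \<omega>)"
    using estimator \<omega> by (simp add: svrg_estimator_def S_target_def)
  ultimately show "state 1 \<omega> = (x0 - \<eta> 0 *\<^sub>R (G_mean n G x0 - \<gamma> 0 *\<^sub>R G_mean n G x0), x0, x0)"
    by (simp add: state_def)
qed

text \<open>
  The state at \<open>k + 1\<close> is a function of the state at \<open>k\<close> and the draw at \<open>k\<close>. Measurability passes on
  because the draws have a countable type, and a finite set of almost sure values because the law
  of a draw has finite support.
\<close>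

lemma state_adapted:
  assumes "k \<ge> 1"
  shows "state k \<in> measurable (F k) (count_space UNIV)"
    and "\<exists>A. finite A \<and> (AE \<omega> in M. state k \<omega> \<in> A)"
proof -
  have *: "state k \<in> measurable (F k) (count_space UNIV) \<and> (\<exists>A. finite A \<and> (AE \<omega> in M. state k \<omega> \<in> A))"
    using assms
  proof (induction k rule: dec_induct)
    case base
    obtain s where s: "\<And>\<omega>. \<omega> \<in> space M \<Longrightarrow> state 1 \<omega> = s"
      using state_1 by blast
    have "state 1 \<in> measurable (F 1) (count_space UNIV)"
      by (subst measurable_cong[of _ _ "\<lambda>_. s"]) (simp_all add: s del: One_nat_def)
    moreover have "AE \<omega> in M. state 1 \<omega> \<in> {s}"
      using s by (intro AE_I2) auto
    ultimately show ?case by blast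
  next
    case (step k)
    then have k: "k \<ge> 1" by simp
    obtain A where A: "finite A" "AE \<omega> in M. state k \<omega> \<in> A"
      using step.IH[THEN conjunct2] by (elim exE conjE)
    have "state k \<in> measurable (F (Suc k)) (count_space UNIV)"
      by (rule measurable_from_subalg[OF subalgebra_F_mono[OF le_SucI[OF order_refl]] step.IH[THEN conjunct1]])
    then have "(\<lambda>\<omega>. next_state k (state k \<omega>) (draw k \<omega>)) \<in> measurable (F (Suc k)) (count_space UNIV)"
      by (rule measurable_fun_countable) (rule measurable_draw_F[OF k lessI])
    moreover have "state (Suc k) \<in> measurable (F (Suc k)) (count_space UNIV)
        \<longleftrightarrow> (\<lambda>\<omega>. next_state k (state k \<omega>) (draw k \<omega>)) \<in> measurable (F (Suc k)) (count_space UNIV)"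
      by (rule measurable_cong) (rule state_Suc[OF k], simp only: space_F)
    ultimately have "state (Suc k) \<in> measurable (F (Suc k)) (count_space UNIV)"
      by (rule rev_iffD2)
    moreover have "AE \<omega> in M. state (Suc k) \<omega> \<in> case_prod (next_state k) ` (A \<times> set_pmf draw_pmf)"
      using A(2) AE_in_set_pmf[OF measurable_draw_M[OF k] distr_draw[OF k]] AE_space
    proof eventually_elim
      case (elim \<omega>)
      have "state (Suc k) \<omega> = case_prod (next_state k) (state k \<omega>, draw k \<omega>)"
        using state_Suc[OF k elim(3)] by (simp only: prod.case)
      then show ?case
        by (rule image_eqI) (rule SigmaI[OF elim(1,2)])
    qed
    moreover have "finite (case_prod (next_state k) ` (A \<times> set_pmf draw_pmf))"
      by (intro finite_imageI finite_cartesian_product A(1) finite_draw_pmf)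
    ultimately show ?case by (intro conjI exI)
  qed
  show "state k \<in> measurable (F k) (count_space UNIV)"
    using * by (rule conjunct1)
  show "\<exists>A. finite A \<and> (AE \<omega> in M. state k \<omega> \<in> A)"
    using * by (rule conjunct2)
qed

lemma fresh_draw_state:
  assumes k: "k \<ge> 1"
  shows "\<exists>A. fresh_draw M (F k) (state k) (draw k) draw_pmf A"
proof -
  obtain A where A: "finite A" "AE \<omega> in M. state k \<omega> \<in> A"
    using state_adapted(2)[OF k] by blast
  have "indep_set (sets (F k)) (sets (vimage_algebra (space M) (draw k) (count_space UNIV)))"
    using sampling[unfolded svrg_sampling_def, rule_format, OF k] by (simp only: draw_algebra_eq)
  then have "fresh_draw M (F k) (state k) (draw k) draw_pmf A"
    using subalgebra_F state_adapted(1)[OF k] A measurable_draw_M[OF k] distr_draw[OF k] finite_draw_pmf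
    by (intro fresh_draw.intro fresh_draw_axioms.intro prob_space_axioms)
  then show ?thesis ..
qed

section \<open>Averages over one draw\<close>

definition mean_sq_residual :: "real \<Rightarrow> real^'p \<Rightarrow> real^'p \<Rightarrow> real^'p \<Rightarrow> real" where
  "mean_sq_residual g u u' v =
    1 / (real n * real b) * (\<Sum>i\<in>{1..n}. (norm (residual G g u u' v i))\<^sup>2)"

definition mean_sq_increment :: "real^'p \<Rightarrow> real^'p \<Rightarrow> real" where
  "mean_sq_increment u u' = 1 / real n * (\<Sum>i\<in>{1..n}. (norm (G i u - G i u'))\<^sup>2)"

definition error where
  "error k = (\<lambda>(u, u', v) (c, B).
     svrg_estimate n G (\<gamma> k) B u u' (snapshot c u' v) - (G_mean n G u - \<gamma> k *\<^sub>R G_mean n G u'))"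

definition new_mean_sq_residual where
  "new_mean_sq_residual k = (\<lambda>(u, u', v) (c, B :: nat list). mean_sq_residual (\<gamma> k) u u' (snapshot c u' v))"

lemma expectation_draw:
  fixes h :: "bool \<times> nat list \<Rightarrow> 'c::{banach, second_countable_topology}"
  shows "(LINT e|draw_pmf. h e) = (LINT c|bernoulli_pmf q. LINT B|batch_pmf. h (c, B))"
  unfolding draw_pmf_def by (rule expectation_pair_pmf_finite) (simp_all add: finite_batch_pmf)

lemma error_given_coin:
  shows "(LINT B|batch_pmf. error k (u, u', v) (c, B)) = 0"
    and "(LINT B|batch_pmf. (norm (error k (u, u', v) (c, B)))\<^sup>2)
      \<le> mean_sq_residual (\<gamma> k) u u' (snapshot c u' v)"
proof -
  have fin: "finite (set_pmf (pmf_of_set {1..n}))"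
    using n by simp
  note dev = batch_mean_deviation[OF fin b, of "residual G (\<gamma> k) u u' (snapshot c u' v)",
      folded batch_pmf_def svrg_estimate_error[OF n]]
  show "(LINT B|batch_pmf. error k (u, u', v) (c, B)) = 0"
    using dev(1) by (simp add: error_def)
  have "(LINT i|pmf_of_set {1..n}. (norm (residual G (\<gamma> k) u u' (snapshot c u' v) i))\<^sup>2) / real b
      = mean_sq_residual (\<gamma> k) u u' (snapshot c u' v)"
    using n by (simp add: integral_pmf_of_set mean_sq_residual_def)
  with dev(2) show "(LINT B|batch_pmf. (norm (error k (u, u', v) (c, B)))\<^sup>2)
      \<le> mean_sq_residual (\<gamma> k) u u' (snapshot c u' v)"
    by (simp add: error_def)
qed

lemma expectation_error: "(LINT e|draw_pmf. error k s e) = 0"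
  by (cases s) (simp add: expectation_draw error_given_coin(1))

lemma expectation_norm_error:
  "(LINT e|draw_pmf. (norm (error k s e))\<^sup>2) \<le> (LINT e|draw_pmf. new_mean_sq_residual k s e)"
proof (cases s)
  case (fields u u' v)
  show ?thesis
    unfolding fields expectation_draw
  proof (rule integral_mono)
    show "(LINT B|batch_pmf. (norm (error k (u, u', v) (c, B)))\<^sup>2)
        \<le> (LINT B|batch_pmf. new_mean_sq_residual k (u, u', v) (c, B))" for c
      using error_given_coin(2) by (simp add: new_mean_sq_residual_def)
  qed (rule integrable_measure_pmf_finite, simp)+
qed

lemma expectation_new_mean_sq_residual:
  assumes "g' < 1"
  shows "(LINT e|draw_pmf. new_mean_sq_residual k (u, u', v) e) / (1 - \<gamma> k)\<^sup>2
    \<le> (1 - q / 2) / (1 - g')\<^sup>2 * mean_sq_residual g' u' u'' v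
      + (4 - 6 * q + 3 * q\<^sup>2) / (real b * q * (1 - \<gamma> k)\<^sup>2) * mean_sq_increment u u'
      + 2 * (2 - 3 * q + q\<^sup>2) * g'\<^sup>2 / (real b * q * (1 - g')\<^sup>2) * mean_sq_increment u' u''"
proof -
  let ?r = "\<lambda>v i. (norm (residual G (\<gamma> k) u u' v i))\<^sup>2"
  let ?r' = "\<lambda>i. (norm (residual G g' u' u'' v i))\<^sup>2"
  let ?d = "\<lambda>u u' i. (norm (G i u - G i u'))\<^sup>2"
  define a1 where "a1 = (1 - q / 2) / (1 - g')\<^sup>2"
  define a2 where "a2 = (4 - 6 * q + 3 * q\<^sup>2) / (q * (1 - \<gamma> k)\<^sup>2)"
  define a3 where "a3 = 2 * (2 - 3 * q + q\<^sup>2) * g'\<^sup>2 / (q * (1 - g')\<^sup>2)"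
  have "(LINT e|draw_pmf. new_mean_sq_residual k (u, u', v) e)
      = q * mean_sq_residual (\<gamma> k) u u' u' + (1 - q) * mean_sq_residual (\<gamma> k) u u' v"
    using q by (simp add: expectation_draw new_mean_sq_residual_def snapshot_def)
  then have "(LINT e|draw_pmf. new_mean_sq_residual k (u, u', v) e) / (1 - \<gamma> k)\<^sup>2
      = 1 / (real n * real b) * (\<Sum>i\<in>{1..n}. (q * ?r u' i + (1 - q) * ?r v i) / (1 - \<gamma> k)\<^sup>2)"
    unfolding mean_sq_residual_def
    by (simp add: sum.distrib add_divide_distrib mult.commute[of "(1 - \<gamma> k)\<^sup>2"]
        flip: sum_distrib_left sum_divide_distrib)
  also have "\<dots> \<le> 1 / (real n * real b)
      * (\<Sum>i\<in>{1..n}. a1 * ?r' i + a2 * ?d u u' i + a3 * ?d u' u'' i)"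
    unfolding a1_def a2_def a3_def residual_def using q \<gamma>[of k] assms
    by (intro mult_left_mono sum_mono residual_recursion) auto
  also have "\<dots> = a1 * mean_sq_residual g' u' u'' v + a2 / real b * mean_sq_increment u u'
      + a3 / real b * mean_sq_increment u' u''"
  proof -
    have "(\<Sum>i\<in>{1..n}. a1 * ?r' i + a2 * ?d u u' i + a3 * ?d u' u'' i)
        = a1 * (\<Sum>i\<in>{1..n}. ?r' i) + a2 * (\<Sum>i\<in>{1..n}. ?d u u' i) + a3 * (\<Sum>i\<in>{1..n}. ?d u' u'' i)"
      by (simp only: sum.distrib sum_distrib_left)
    then show ?thesis
      unfolding mean_sq_residual_def mean_sq_increment_def
      by (simp only: distrib_left times_divide_eq_left times_divide_eq_right divide_divide_eq_left
          mult_1_left mult.commute[of "real b"])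
  qed
  also have "a2 / real b = (4 - 6 * q + 3 * q\<^sup>2) / (real b * q * (1 - \<gamma> k)\<^sup>2)"
    by (simp add: a2_def mult.commute mult.left_commute)
  also have "a3 / real b = 2 * (2 - 3 * q + q\<^sup>2) * g'\<^sup>2 / (real b * q * (1 - g')\<^sup>2)"
    by (simp add: a3_def mult.commute mult.left_commute)
  finally show ?thesis
    unfolding a1_def .
qed

section \<open>The variance-reduction property\<close>

lemma St_error:
  assumes "k \<ge> 1" "\<omega> \<in> space M"
  shows "St k \<omega> - S_target n G \<gamma> x k \<omega> = error k (state k \<omega>) (draw k \<omega>)"
  using assms by (simp add: St_eq w_eq S_target_def error_def state_def draw_def)

definition \<Delta> :: "nat \<Rightarrow> 'a \<Rightarrow> real" where
  "\<Delta> k \<omega> = mean_sq_residual (\<gamma> k) (x k \<omega>) (x (k - 1) \<omega>) (w k \<omega>)"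

definition U :: "nat \<Rightarrow> 'a \<Rightarrow> real" where
  "U k \<omega> = mean_sq_increment (x k \<omega>) (x (k - 1) \<omega>)"

lemma \<Delta>_eq:
  assumes "k \<ge> 1" "\<omega> \<in> space M"
  shows "\<Delta> k \<omega> = new_mean_sq_residual k (state k \<omega>) (draw k \<omega>)"
  using assms by (simp add: \<Delta>_def w_eq new_mean_sq_residual_def state_def draw_def)

lemma \<Delta>_nonneg: "0 \<le> \<Delta> k \<omega>"
  by (simp add: \<Delta>_def mean_sq_residual_def sum_nonneg)

lemma U_nonneg: "0 \<le> U k \<omega>"
  by (simp add: U_def mean_sq_increment_def sum_nonneg)

text \<open>Iteration 0 makes no draw, so the measurability of \<open>\<Delta> 0\<close> rests on this value.\<close>

lemma \<Delta>_0: "\<omega> \<in> space M \<Longrightarrow> \<Delta> 0 \<omega> = 0"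
  using snapshots by (simp add: \<Delta>_def mean_sq_residual_def residual_def svrg_snapshots_def algebra_simps)

lemma integrability:
  assumes k: "k \<ge> 1"
  shows "integrable M (\<lambda>\<omega>. St k \<omega> - S_target n G \<gamma> x k \<omega>)"
    and "integrable M (\<lambda>\<omega>. (norm (St k \<omega> - S_target n G \<gamma> x k \<omega>))\<^sup>2)"
    and "integrable M (\<Delta> k)"
proof -
  obtain A where "fresh_draw M (F k) (state k) (draw k) draw_pmf A"
    using fresh_draw_state[OF k] by blast
  then interpret fresh_draw M "F k" "state k" "draw k" draw_pmf A .
  show "integrable M (\<lambda>\<omega>. St k \<omega> - S_target n G \<gamma> x k \<omega>)"
    by (rule integrable_fun[where f = "error k"]) (rule St_error[OF k])
  show "integrable M (\<lambda>\<omega>. (norm (St k \<omega> - S_target n G \<gamma> x k \<omega>))\<^sup>2)"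
    by (rule integrable_fun[where f = "\<lambda>s e. (norm (error k s e))\<^sup>2"]) (simp only: St_error[OF k])
  show "integrable M (\<Delta> k)"
    by (rule integrable_fun[where f = "new_mean_sq_residual k"]) (rule \<Delta>_eq[OF k])
qed

text \<open>
  \<^const>\<open>vec_cond_exp\<close> is taken componentwise, so the vector-valued mean zero of the error is used
  in every coordinate.
\<close>

theorem unbiased:
  assumes k: "k \<ge> 1"
  shows "AE \<omega> in M. vec_cond_exp M (F k) (\<lambda>\<omega>. St k \<omega> - S_target n G \<gamma> x k \<omega>) \<omega> = 0"
proof -
  obtain A where "fresh_draw M (F k) (state k) (draw k) draw_pmf A"
    using fresh_draw_state[OF k] by blast
  then interpret fresh_draw M "F k" "state k" "draw k" draw_pmf A .
  have "AE \<omega> in M. \<forall>j\<in>UNIV. real_cond_exp M (F k) (\<lambda>\<omega>. (St k \<omega> - S_target n G \<gamma> x k \<omega>) $ j) \<omega> = 0"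
  proof (rule AE_finite_allI)
    fix j :: 'p
    have "(LINT e|draw_pmf. error k s e $ j) = (LINT e|draw_pmf. error k s e) $ j" for s
      by (rule integral_bounded_linear[OF bounded_linear_vec_nth])
        (rule integrable_measure_pmf_finite[OF finite_draw_pmf])
    then have zero: "(LINT e|draw_pmf. error k s e $ j) = 0" for s
      by (simp only: expectation_error zero_index)
    have "AE \<omega> in M. real_cond_exp M (F k) (\<lambda>\<omega>. (St k \<omega> - S_target n G \<gamma> x k \<omega>) $ j) \<omega>
        = (LINT e|draw_pmf. error k (state k \<omega>) e $ j)"
      by (rule cond_exp_fun) (simp only: St_error[OF k])
    then show "AE \<omega> in M. real_cond_exp M (F k) (\<lambda>\<omega>. (St k \<omega> - S_target n G \<gamma> x k \<omega>) $ j) \<omega> = 0"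
      by (simp only: zero)
  qed simp
  then show ?thesis
    by (rule eventually_mono) (simp add: vec_cond_exp_def vec_eq_iff)
qed

theorem variance_bound:
  assumes k: "k \<ge> 1"
  shows "AE \<omega> in M. real_cond_exp M (F k) (\<lambda>\<omega>. (norm (St k \<omega> - S_target n G \<gamma> x k \<omega>))\<^sup>2) \<omega>
    \<le> real_cond_exp M (F k) (\<Delta> k) \<omega>"
proof -
  obtain A where "fresh_draw M (F k) (state k) (draw k) draw_pmf A"
    using fresh_draw_state[OF k] by blast
  then interpret fresh_draw M "F k" "state k" "draw k" draw_pmf A .
  have "AE \<omega> in M. real_cond_exp M (F k) (\<lambda>\<omega>. (norm (St k \<omega> - S_target n G \<gamma> x k \<omega>))\<^sup>2) \<omega>
      = (LINT e|draw_pmf. (norm (error k (state k \<omega>) e))\<^sup>2)"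
    by (rule cond_exp_fun) (simp only: St_error[OF k])
  moreover have "AE \<omega> in M. real_cond_exp M (F k) (\<Delta> k) \<omega>
      = (LINT e|draw_pmf. new_mean_sq_residual k (state k \<omega>) e)"
    by (rule cond_exp_fun) (rule \<Delta>_eq[OF k])
  ultimately show ?thesis
    by eventually_elim (simp only: expectation_norm_error)
qed

text \<open>
  The bound for a frozen state is used with \<open>u'' = x (k - 1 - 1)\<close>; for \<open>k = 1\<close> this is \<open>x 0\<close>, in
  agreement with the convention that the iterate before \<open>x 0\<close> is \<open>x 0\<close>.
\<close>

theorem recursion:
  assumes k: "k \<ge> 1"
  shows "AE \<omega> in M. 1 / (1 - \<gamma> k)\<^sup>2 * real_cond_exp M (F k) (\<Delta> k) \<omega>
    \<le> (1 - q / 2) * (1 / (1 - \<gamma> (k - 1))\<^sup>2) * \<Delta> (k - 1) \<omega>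
      + (4 - 6 * q + 3 * q\<^sup>2) / (real b * q * (1 - \<gamma> k)\<^sup>2) * U k \<omega>
      + 2 * (2 - 3 * q + q\<^sup>2) * (\<gamma> (k - 1))\<^sup>2 / (real b * q * (1 - \<gamma> (k - 1))\<^sup>2) * U (k - 1) \<omega>"
proof -
  obtain A where "fresh_draw M (F k) (state k) (draw k) draw_pmf A"
    using fresh_draw_state[OF k] by blast
  then interpret fresh_draw M "F k" "state k" "draw k" draw_pmf A .
  have "\<gamma> (k - 1) < 1"
    using \<gamma> by blast
  note bound = expectation_new_mean_sq_residual[OF this, of k]
  have "AE \<omega> in M. real_cond_exp M (F k) (\<Delta> k) \<omega>
      = (LINT e|draw_pmf. new_mean_sq_residual k (state k \<omega>) e)"
    by (rule cond_exp_fun) (rule \<Delta>_eq[OF k])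
  then show ?thesis
  proof eventually_elim
    case (elim \<omega>)
    then show ?case
      using bound[of "x k \<omega>" "x (k - 1) \<omega>" "w (k - 1) \<omega>" "x (k - 1 - 1) \<omega>"]
      by (simp only: state_def \<Delta>_def U_def times_divide_eq_left times_divide_eq_right mult_1_left mult_1_right)
  qed
qed

theorem variance_reduced:
  "vr_unbiased_with M F \<gamma> (S_target n G \<gamma> x) St U
     (q / 2) ((4 - 6 * q + 3 * q\<^sup>2) / (real b * q)) (2 * (2 - 3 * q + q\<^sup>2) / (real b * q)) \<Delta>"
  unfolding vr_unbiased_with_def
proof (intro conjI allI impI ballI)
  have "4 - 6 * q + 3 * q\<^sup>2 = 1 + 3 * (1 - q)\<^sup>2"
    by (simp add: power2_eq_square algebra_simps)
  also have "\<dots> > 0"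
    by (simp add: add_pos_nonneg)
  finally show "0 < (4 - 6 * q + 3 * q\<^sup>2) / (real b * q)"
    using q b by simp
  have "2 - 3 * q + q\<^sup>2 = (1 - q) * (2 - q)"
    by (simp add: power2_eq_square algebra_simps)
  then have pos: "0 \<le> 2 - 3 * q + q\<^sup>2"
    using q by simp
  then show "0 \<le> 2 * (2 - 3 * q + q\<^sup>2) / (real b * q)"
    using q by simp
  show "\<Delta> k \<in> borel_measurable M" for k
  proof (cases "k = 0")
    case True
    have "\<Delta> 0 \<in> borel_measurable M \<longleftrightarrow> (\<lambda>_. 0 :: real) \<in> borel_measurable M"
      by (rule measurable_cong) (rule \<Delta>_0)
    with True show ?thesis by simp
  next
    case False
    then show ?thesis by (intro borel_measurable_integrable integrability(3)) simp
  qed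
  fix k :: nat assume k: "k \<ge> 1"
  show "AE \<omega> in M. 1 / (1 - \<gamma> k)\<^sup>2 * real_cond_exp M (F k) (\<Delta> k) \<omega>
    \<le> (1 - q / 2) / (1 - \<gamma> (k - 1))\<^sup>2 * \<Delta> (k - 1) \<omega>
      + (4 - 6 * q + 3 * q\<^sup>2) / (real b * q) / (1 - \<gamma> k)\<^sup>2 * U k \<omega>
      + 2 * (2 - 3 * q + q\<^sup>2) / (real b * q) / (1 - \<gamma> (k - 1))\<^sup>2 * U (k - 1) \<omega>"
    using recursion[OF k]
  proof eventually_elim
    case (elim \<omega>)
    \<comment> \<open>The recursion has the sharper last term, with the factor \<open>(\<gamma> (k - 1))\<^sup>2\<close>.\<close>
    have "(\<gamma> (k - 1))\<^sup>2 \<le> 1"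
      using \<gamma>[of "k - 1"] by (intro power_le_one) auto
    then have "2 * (2 - 3 * q + q\<^sup>2) * (\<gamma> (k - 1))\<^sup>2 / (real b * q * (1 - \<gamma> (k - 1))\<^sup>2) * U (k - 1) \<omega>
        \<le> 2 * (2 - 3 * q + q\<^sup>2) / (real b * q * (1 - \<gamma> (k - 1))\<^sup>2) * U (k - 1) \<omega>"
      using pos q by (intro mult_right_mono divide_right_mono U_nonneg) (auto intro: mult_left_le)
    with elim show ?case by simp
  qed
qed (use q in \<open>simp_all add: integrability unbiased variance_bound \<Delta>_nonneg\<close>)

end

theorem lemma1:
  fixes M :: "'a measure"
    and G :: "nat \<Rightarrow> real^'p \<Rightarrow> real^'p"
    and n b :: nat
    and q :: real
    and \<gamma> \<theta> \<eta> :: "nat \<Rightarrow> real"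
    and x0 :: "real^'p"
    and coin :: "nat \<Rightarrow> 'a \<Rightarrow> bool"
    and batch :: "nat \<Rightarrow> 'a \<Rightarrow> nat list"
    and x w S St :: "nat \<Rightarrow> 'a \<Rightarrow> real^'p"
    and \<Delta> U :: "nat \<Rightarrow> 'a \<Rightarrow> real"
    and F :: "nat \<Rightarrow> 'a measure"
  assumes "prob_space M"
    and "n \<ge> 1" and "b \<ge> 1"
    and "0 < q" and "q < 1"
    and "\<And>k. 0 \<le> \<gamma> k \<and> \<gamma> k < 1"
    and "svrg_sampling M n b q coin batch"
    and "vfkm M \<theta> \<eta> x0 St x"
    and "svrg_snapshots M coin x w"
    and "svrg_estimator M n G \<gamma> batch x w St"
    and "S = S_target n G \<gamma> x"
    and "F = history M coin batch"
    and "\<And>k \<omega>. \<Delta> k \<omega> = 1 / (real n * real b) *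
           (\<Sum>i\<in>{1..n}. (norm (G i (x k \<omega>) - \<gamma> k *\<^sub>R G i (x (k - 1) \<omega>)
                                - (1 - \<gamma> k) *\<^sub>R G i (w k \<omega>)))\<^sup>2)"
    and "\<And>k \<omega>. U k \<omega> = 1 / real n * (\<Sum>i\<in>{1..n}. (norm (G i (x k \<omega>) - G i (x (k - 1) \<omega>)))\<^sup>2)"
  shows "(\<forall>k\<ge>1.
           (AE \<omega> in M. vec_cond_exp M (F k) (\<lambda>\<omega>. St k \<omega> - S k \<omega>) \<omega> = 0) \<and>
           (AE \<omega> in M. real_cond_exp M (F k) (\<lambda>\<omega>. (norm (St k \<omega> - S k \<omega>))\<^sup>2) \<omega>
                         \<le> real_cond_exp M (F k) (\<Delta> k) \<omega>) \<and>
           (AE \<omega> in M. 1 / (1 - \<gamma> k)\<^sup>2 * real_cond_exp M (F k) (\<Delta> k) \<omega>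
                         \<le> (1 - q / 2) * (1 / (1 - \<gamma> (k - 1))\<^sup>2) * \<Delta> (k - 1) \<omega>
                           + (4 - 6 * q + 3 * q\<^sup>2) / (real b * q * (1 - \<gamma> k)\<^sup>2) * U k \<omega>
                           + 2 * (2 - 3 * q + q\<^sup>2) * (\<gamma> (k - 1))\<^sup>2
                               / (real b * q * (1 - \<gamma> (k - 1))\<^sup>2) * U (k - 1) \<omega>))
       \<and> vr_unbiased_with M F \<gamma> S St U
           (q / 2)
           ((4 - 6 * q + 3 * q\<^sup>2) / (real b * q))
           (2 * (2 - 3 * q + q\<^sup>2) / (real b * q))
           \<Delta>
       \<and> vr_unbiased_estimator M F \<gamma> S St U"
proof -
  interpret svrg M G n b q \<gamma> \<theta> \<eta> x0 coin batch x w St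
    using assms(1-10) by (intro svrg.intro svrg_axioms.intro) simp_all
  have \<Delta>: "\<Delta> = svrg.\<Delta> G n b \<gamma> x w" and U: "U = svrg.U G n x"
    by (intro ext; simp add: assms(13,14) \<Delta>_def U_def mean_sq_residual_def mean_sq_increment_def residual_def)+
  have "vr_unbiased_with M F \<gamma> S St U (q / 2)
      ((4 - 6 * q + 3 * q\<^sup>2) / (real b * q)) (2 * (2 - 3 * q + q\<^sup>2) / (real b * q)) \<Delta>"
    using variance_reduced unfolding \<Delta> U assms(11,12) .
  moreover from this have "vr_unbiased_estimator M F \<gamma> S St U"
    unfolding vr_unbiased_estimator_def by blast
  ultimately show ?thesis
    unfolding \<Delta> U assms(11,12) using unbiased variance_bound recursion by blast
qed

end
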